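(* Suppose $\mathcal{B}=(\boldsymbol{x}_n)_{n=1}^\infty$ is a $1$-symmetric total basis of a Banach space $\mathbb{X}$ which fails to be $1$-suppression unconditional. Then $\mathcal{B}$ is equivalent to the canonical $\ell_1$-basis.
   Context: Banach spaces are over $\mathbb{F}=\mathbb{R}$ or $\mathbb{C}$; $c_{00}$ is the space of finitely supported scalar sequences. Basis: a basis of a Banach space $\mathbb{X}$ is a sequence $\mathcal{B}=(\boldsymbol{x}_n)_{n=1}^\infty$ in $\mathbb{X}$ whose linear span is dense in $\mathbb{X}$, for which there is a (necessarily unique) sequence $\mathcal{B}^*=(\boldsymbol{x}_n^* )_{n=1}^\infty$ in $\mathbb{X}^*$ biorthogonal to $\mathcal{B}$, and such that $\sup_n\max\{\|\boldsymbol{x}_n\|,\|\boldsymbol{x}_n^*\|\}<\infty$. It is total if the span of $\mathcal{B}^*$ is weak$^*$-dense in $\mathbb{X}^*$ (totality is not part of the definition of basis). $1$-symmetric: $\|\sum_n a_n\boldsymbol{x}_n\|\le\|\sum_n a_n\boldsymbol{x}_{\pi(n)}\|$ for all $(a_n)\in c_{00}$ and all permutations $\pi$ of $\mathbb{N}$. $1$-suppression unconditional: $\|\sum_{n\in A}\boldsymbol{x}_n^*(x)\boldsymbol{x}_n\|\le\|x\|$ for all finite $A\subset\mathbb{N}$ and all $x\in\mathbb{X}$. Equivalent to the canonical $\ell_1$-basis: there is $C\ge1$ with $C^{-1}\sum_n|a_n|\le\|\sum_n a_n\boldsymbol{x}_n\|\le C\sum_n|a_n|$ for all $(a_n)\in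 c_{00}$. *)

theory Defs
  imports "HOL-Analysis.Analysis" "HOL-Library.Function_Algebras"
begin

text \<open>
  Sequences are indexed from \<open>0\<close>. The scalar field is kept generic; it is meant to be
  \<^typ>\<open>real\<close> (with \<^term>\<open>scaleR\<close>) or \<^typ>\<open>complex\<close>. As there is no type class of complex normed
  spaces, a complex structure on a real normed space is given by an explicit scalar multiplication.
\<close>

locale normed_space_over = vector_space sm
  for sm :: "'f::real_normed_field \<Rightarrow> 'a::real_normed_vector \<Rightarrow> 'a" +
  assumes norm_scale: "norm (sm c v) = norm c * norm v"
    and scale_of_real: "sm (of_real r) v = r *\<^sub>R v"

lemma normed_space_over_scaleR:
  "normed_space_over (scaleR :: real \<Rightarrow> 'a \<Rightarrow> 'a::real_normed_vector)"
  by unfold_locales (simp_all add: algebra_simps)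

definition dual_space ::
  "('f::real_normed_field \<Rightarrow> 'a::real_normed_vector \<Rightarrow> 'a) \<Rightarrow> ('a \<Rightarrow> 'f) set" where
  "dual_space sm = {f. Vector_Spaces.linear sm (*) f \<and> bounded_linear f}"

text \<open>The topology of the type \<^typ>\<open>'a \<Rightarrow> 'f\<close> is that of pointwise convergence.\<close>

definition weak_star_topology ::
  "('f::real_normed_field \<Rightarrow> 'a::real_normed_vector \<Rightarrow> 'a) \<Rightarrow> ('a \<Rightarrow> 'f) topology" where
  "weak_star_topology sm = top_of_set (dual_space sm)"

text \<open>
  The biorthogonal sequence \<open>x'\<close>, which is uniquely determined by \<open>x\<close>, is a parameter.
  On \<^term>\<open>dual_space sm\<close>, \<^const>\<open>onorm\<close> is the dual norm.
\<close>

definition is_basis ::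
  "('f::real_normed_field \<Rightarrow> 'a::real_normed_vector \<Rightarrow> 'a) \<Rightarrow> (nat \<Rightarrow> 'a) \<Rightarrow> (nat \<Rightarrow> 'a \<Rightarrow> 'f) \<Rightarrow> bool" where
  "is_basis sm x x' \<longleftrightarrow>
     closure (module.span sm (range x)) = UNIV \<and>
     (\<forall>n. x' n \<in> dual_space sm) \<and>
     (\<forall>n m. x' n (x m) = (if n = m then 1 else 0)) \<and>
     bdd_above (range (\<lambda>n. max (norm (x n)) (onorm (x' n))))"

definition total_basis ::
  "('f::real_normed_field \<Rightarrow> 'a::real_normed_vector \<Rightarrow> 'a) \<Rightarrow> (nat \<Rightarrow> 'a) \<Rightarrow> (nat \<Rightarrow> 'a \<Rightarrow> 'f) \<Rightarrow> bool" where
  "total_basis sm x x' \<longleftrightarrow>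
     is_basis sm x x' \<and>
     weak_star_topology sm closure_of module.span (\<lambda>c f v. c * f v) (range x')
       = dual_space sm"

definition one_symmetric ::
  "('f::real_normed_field \<Rightarrow> 'a::real_normed_vector \<Rightarrow> 'a) \<Rightarrow> (nat \<Rightarrow> 'a) \<Rightarrow> bool" where
  "one_symmetric sm x \<longleftrightarrow>
     (\<forall>a \<pi>. finite {n. a n \<noteq> 0} \<longrightarrow> bij \<pi> \<longrightarrow>
        norm (\<Sum>n | a n \<noteq> 0. sm (a n) (x n)) \<le> norm (\<Sum>n | a n \<noteq> 0. sm (a n) (x (\<pi> n))))"

definition one_suppression_unconditional ::
  "('f::real_normed_field \<Rightarrow> 'a::real_normed_vector \<Rightarrow> 'a) \<Rightarrow> (nat \<Rightarrow> 'a) \<Rightarrow> (nat \<Rightarrow> 'a \<Rightarrow> 'f) \<Rightarrow> bool" where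
  "one_suppression_unconditional sm x x' \<longleftrightarrow>
     (\<forall>A v. finite A \<longrightarrow> norm (\<Sum>n\<in>A. sm (x' n v) (x n)) \<le> norm v)"

definition equivalent_l1 ::
  "('f::real_normed_field \<Rightarrow> 'a::real_normed_vector \<Rightarrow> 'a) \<Rightarrow> (nat \<Rightarrow> 'a) \<Rightarrow> bool" where
  "equivalent_l1 sm x \<longleftrightarrow>
     (\<exists>C\<ge>1. \<forall>a. finite {n. a n \<noteq> 0} \<longrightarrow>
        inverse C * (\<Sum>n | a n \<noteq> 0. norm (a n)) \<le> norm (\<Sum>n | a n \<noteq> 0. sm (a n) (x n)) \<and>
        norm (\<Sum>n | a n \<noteq> 0. sm (a n) (x n)) \<le> C * (\<Sum>n | a n \<noteq> 0. norm (a n)))"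

end

theory Submission
  imports Defs
begin

text \<open>
  For a finite nonempty set \<open>D\<close> of indices let \<open>u\<^sub>D\<close> be the arithmetic mean of the vectors \<open>x i\<close>,
  \<open>i \<in> D\<close>. The engine of the proof is that symmetry makes averaging over placements of a block
  contractive: if \<open>A\<close> is a block of the support of \<open>f = (\<Sum>i. a\<^sub>i x\<^sub>i)\<close>, then moving \<open>A\<close> cyclically
  through a set \<open>D\<close> that is at least as large, and averaging, replaces this part of \<open>f\<close> by
  \<open>(\<Sum>i\<in>A. a\<^sub>i) u\<^sub>D\<close> without increasing the norm; two blocks can be treated at once
  (\<open>norm_average_two_blocks_le\<close>). This has three consequences.

  If the norms \<open>\<parallel>u\<^sub>D\<parallel>\<close> come arbitrarily close to \<open>0\<close>, the averaged block disappears in the limit, so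
  that suppressing a block does not increase the norm: the basis is 1-suppression unconditional
  (\<open>small_means_imp_suppression\<close>). Hence, under the hypothesis, \<open>\<parallel>u\<^sub>D\<parallel> \<ge> d > 0\<close> for all \<open>D\<close>, and
  averaging the entire support gives \<open>d \<bar>\<Sum>i. a\<^sub>i\<bar> \<le> \<parallel>f\<parallel>\<close>. The sum of the coefficients thus extends to a
  bounded functional \<open>S\<close>.

  If disjoint means came arbitrarily close to each other, the means \<open>u\<^sub>D\<close> over growing initial segments
  would form a Cauchy sequence. Its limit \<open>y\<close> has all coordinates \<open>0\<close>, whereas \<open>S y = 1\<close>; so \<open>S\<close> is not
  in the weak-star closure of the span of the coordinate functionals, which contradicts totality.
  Hence \<open>\<parallel>u\<^sub>D - u\<^sub>E\<parallel> \<ge> e > 0\<close> for all disjoint \<open>D\<close> and \<open>E\<close> (\<open>means_separated\<close>).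

  Finally, split the support of \<open>f\<close> into two blocks with coefficient sums \<open>s\<close> and \<open>t\<close>. Averaging gives
  \<open>\<parallel>s u\<^sub>D + t u\<^sub>E\<parallel> \<le> \<parallel>f\<parallel>\<close> and, with the roles of \<open>D\<close> and \<open>E\<close> exchanged, \<open>\<parallel>s u\<^sub>E + t u\<^sub>D\<parallel> \<le> \<parallel>f\<parallel>\<close>.
  The difference controls \<open>s - t\<close>, the functional \<open>S\<close> controls \<open>s + t\<close>, and so every partial sum \<open>s\<close> of
  the coefficients is at most a constant times \<open>\<parallel>f\<parallel>\<close> (\<open>norm_partial_sum_coeffs_le\<close>). For real or
  complex scalars the largest partial sum dominates \<open>\<Sum>i. \<bar>a\<^sub>i\<bar>\<close> up to a factor of \<open>2\<close> or \<open>4\<close>, which is the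
  lower \<open>\<ell>\<^sub>1\<close>-estimate; the upper one only expresses that the basis vectors are bounded.
\<close>

section \<open>Rearranging finite index sets\<close>

text \<open>
  The symmetry hypothesis speaks of permutations of all indices, but only the images of finitely many
  indices matter. The two complements inside the finite set \<open>I \<union> \<sigma> ` I\<close> have the same
  cardinality, so \<open>\<sigma>\<close> can be completed to a permutation there and to the identity outside.
\<close>

lemma inj_on_finite_extends_to_bij:
  assumes "finite I" "inj_on \<sigma> I"
  obtains \<pi> :: "'i \<Rightarrow> 'i" where "bij \<pi>" "\<forall>i\<in>I. \<pi> i = \<sigma> i"
proof -
  define F where "F = I \<union> \<sigma> ` I"
  have F: "finite F" "I \<subseteq> F" "\<sigma> ` I \<subseteq> F" using assms by (auto simp: F_def)
  have "card (F - I) = card (F - \<sigma> ` I)"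
    using F assms by (simp add: card_Diff_subset card_image)
  then obtain h where h: "bij_betw h (F - I) (F - \<sigma> ` I)"
    using F(1) by (metis finite_Diff finite_same_card_bij)
  define g where "g = (\<lambda>i. if i \<in> I then \<sigma> i else h i)"
  have "bij_betw g I (\<sigma> ` I)"
    using inj_on_imp_bij_betw[OF assms(2)]
    by (rule bij_betw_cong[THEN iffD1, rotated]) (simp add: g_def)
  moreover have "bij_betw g (F - I) (F - \<sigma> ` I)"
    using h by (rule bij_betw_cong[THEN iffD1, rotated]) (simp add: g_def)
  ultimately have "bij_betw g (I \<union> (F - I)) (\<sigma> ` I \<union> (F - \<sigma> ` I))"
    by (rule bij_betw_combine) auto
  then have gF: "bij_betw g F F" using F by (simp add: Un_absorb1)
  define \<pi> where "\<pi> = (\<lambda>i. if i \<in> F then g i else i)"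
  have "bij_betw \<pi> F F" "bij_betw \<pi> (- F) (- F)"
    using gF by (auto simp: \<pi>_def bij_betw_def inj_on_def)
  then have "bij_betw \<pi> (F \<union> - F) (F \<union> - F)"
    by (rule bij_betw_combine) auto
  then have "bij \<pi>" by simp
  moreover have "\<forall>i\<in>I. \<pi> i = \<sigma> i"
    using F by (auto simp: \<pi>_def g_def)
  ultimately show ?thesis using that by blast
qed

text \<open>
  Number the elements of \<open>D\<close> cyclically and place \<open>A\<close> on \<open>card A\<close> of these numbers; \<open>\<tau> k\<close> is this
  placement shifted by \<open>k\<close>. Each shift is injective, and during one full turn each element of \<open>A\<close>
  visits each element of \<open>D\<close> exactly once.
\<close>

lemma obtain_cyclic_placements:
  assumes "finite A" "finite D" "card A \<le> card D"
  obtains \<tau> :: "nat \<Rightarrow> 'i \<Rightarrow> 'j"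
  where "\<forall>k. inj_on (\<tau> k) A" "\<forall>k. \<tau> k ` A \<subseteq> D"
    "\<forall>i\<in>A. bij_betw (\<lambda>k. \<tau> k i) {..<card D} D"
proof -
  let ?N = "card D"
  obtain d where d: "bij_betw d {..<?N} D"
    using ex_bij_betw_nat_finite[OF assms(2)] by (auto simp: atLeast0LessThan)
  obtain e where e: "e ` A \<subseteq> {..<?N}" "inj_on e A"
    using card_le_inj[OF assms(1), of "{..<?N}"] assms(3) by auto
  define \<tau> where "\<tau> = (\<lambda>k i. d ((e i + k) mod ?N))"
  have shift: "j = l" if "(j + k) mod ?N = (l + k) mod ?N" "j < ?N" "l < ?N" for j k l
  proof (cases "j \<le> l")
    case True
    then have "?N dvd l - j"
      using that(1) mod_eq_dvd_iff_nat[of "j + k" "l + k" ?N] by simp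
    then show ?thesis using True that(3) by (auto dest!: dvd_imp_le)
  next
    case False
    then have "?N dvd j - l"
      using that(1) mod_eq_dvd_iff_nat[of "l + k" "j + k" ?N] by simp
    then show ?thesis using False that(2) by (auto dest!: dvd_imp_le)
  qed
  have pos: "0 < ?N" if "i \<in> A" for i
    using e(1) that by auto
  have lt: "(e i + k) mod ?N < ?N" if "i \<in> A" for i k
    using pos[OF that] by simp
  show ?thesis
  proof
    show "\<forall>k. inj_on (\<tau> k) A"
    proof (intro allI, rule inj_onI)
      fix k i j assume ij: "i \<in> A" "j \<in> A" "\<tau> k i = \<tau> k j"
      have "(e i + k) mod ?N = (e j + k) mod ?N"
        by (rule inj_onD[OF bij_betw_imp_inj_on[OF d]]) (use ij lt in \<open>simp_all add: \<tau>_def\<close>)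
      then have "e i = e j"
        using ij e(1) by (intro shift[of "e i" k "e j"]) auto
      then show "i = j" using e(2) ij by (auto dest: inj_onD)
    qed
    show "\<forall>k. \<tau> k ` A \<subseteq> D"
      using lt bij_betwE[OF d] by (simp add: \<tau>_def image_subset_iff)
    show "\<forall>i\<in>A. bij_betw (\<lambda>k. \<tau> k i) {..<?N} D"
    proof
      fix i assume i: "i \<in> A"
      have "inj_on (\<lambda>k. (e i + k) mod ?N) {..<?N}"
        by (rule inj_onI, rule shift[where k = "e i"]) (simp_all add: add.commute)
      moreover have "(\<lambda>k. (e i + k) mod ?N) ` {..<?N} \<subseteq> {..<?N}"
        using lt[OF i] by auto
      ultimately have "bij_betw (\<lambda>k. (e i + k) mod ?N) {..<?N} {..<?N}"
        by (simp add: bij_betw_def endo_inj_surj)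
      from bij_betw_trans[OF this d] show "bij_betw (\<lambda>k. \<tau> k i) {..<?N} D"
        by (simp add: \<tau>_def comp_def)
    qed
  qed
qed

lemma obtain_disjoint_set_of_card:
  assumes "finite F"
  obtains D :: "nat set" where "finite D" "card D = n" "D \<inter> F = {}"
proof -
  have "infinite (- F)" using assms by (simp add: finite_compl)
  from infinite_arbitrarily_large[OF this, of n] show ?thesis using that by blast
qed

text \<open>
  Either the positive or the negative terms account for half of the sum of the absolute values.
\<close>

lemma real_subset_sum_ge_half:
  fixes a :: "'i \<Rightarrow> real"
  assumes "finite I"
  shows "\<exists>A\<subseteq>I. (\<Sum>i\<in>I. \<bar>a i\<bar>) \<le> 2 * \<bar>\<Sum>i\<in>A. a i\<bar>"
proof -
  define P where "P = {i\<in>I. 0 < a i}"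
  have P: "P \<subseteq> I" by (auto simp: P_def)
  have "(\<Sum>i\<in>I. \<bar>a i\<bar>) = (\<Sum>i\<in>P. \<bar>a i\<bar>) + (\<Sum>i\<in>I - P. \<bar>a i\<bar>)"
    using sum.subset_diff[OF P assms, of "\<lambda>i. \<bar>a i\<bar>"] by simp
  also have "(\<Sum>i\<in>P. \<bar>a i\<bar>) = (\<Sum>i\<in>P. a i)"
    by (rule sum.cong) (auto simp: P_def)
  also have "(\<Sum>i\<in>I - P. \<bar>a i\<bar>) = - (\<Sum>i\<in>I - P. a i)"
    unfolding sum_negf[symmetric] by (rule sum.cong) (auto simp: P_def)
  finally have *: "(\<Sum>i\<in>I. \<bar>a i\<bar>) \<le> \<bar>\<Sum>i\<in>P. a i\<bar> + \<bar>\<Sum>i\<in>I - P. a i\<bar>" by simp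
  show ?thesis
  proof (cases "\<bar>\<Sum>i\<in>P. a i\<bar> \<le> \<bar>\<Sum>i\<in>I - P. a i\<bar>")
    case True
    then show ?thesis using * by (intro exI[of _ "I - P"]) auto
  next
    case False
    then show ?thesis using * P by (intro exI[of _ P]) auto
  qed
qed

text \<open>
  The factor \<open>4\<close> comes from applying the real case to the real and to the imaginary parts and keeping
  the better of the two index sets.
\<close>

lemma complex_subset_sum_ge_quarter:
  fixes a :: "'i \<Rightarrow> complex"
  assumes "finite I"
  shows "\<exists>A\<subseteq>I. (\<Sum>i\<in>I. norm (a i)) \<le> 4 * norm (\<Sum>i\<in>A. a i)"
proof -
  obtain A where A: "A \<subseteq> I" "(\<Sum>i\<in>I. \<bar>Re (a i)\<bar>) \<le> 2 * \<bar>\<Sum>i\<in>A. Re (a i)\<bar>"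
    using real_subset_sum_ge_half[OF assms, of "\<lambda>i. Re (a i)"] by blast
  obtain B where B: "B \<subseteq> I" "(\<Sum>i\<in>I. \<bar>Im (a i)\<bar>) \<le> 2 * \<bar>\<Sum>i\<in>B. Im (a i)\<bar>"
    using real_subset_sum_ge_half[OF assms, of "\<lambda>i. Im (a i)"] by blast
  have "(\<Sum>i\<in>I. norm (a i)) \<le> (\<Sum>i\<in>I. \<bar>Re (a i)\<bar> + \<bar>Im (a i)\<bar>)"
    by (intro sum_mono cmod_le)
  also have "\<dots> \<le> 2 * \<bar>Re (\<Sum>i\<in>A. a i)\<bar> + 2 * \<bar>Im (\<Sum>i\<in>B. a i)\<bar>"
    using A(2) B(2) by (simp add: sum.distrib)
  also have "\<dots> \<le> 2 * norm (\<Sum>i\<in>A. a i) + 2 * norm (\<Sum>i\<in>B. a i)"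
    by (intro add_mono mult_left_mono abs_Re_le_cmod abs_Im_le_cmod) auto
  finally have *: "(\<Sum>i\<in>I. norm (a i)) \<le> \<dots>" .
  show ?thesis
  proof (cases "norm (\<Sum>i\<in>A. a i) \<le> norm (\<Sum>i\<in>B. a i)")
    case True
    then show ?thesis using * B by (intro exI[of _ B]) auto
  next
    case False
    then show ?thesis using * A by (intro exI[of _ A]) auto
  qed
qed

section \<open>Averaging over placements in a symmetric basis\<close>

locale symmetric_basis = normed_space_over sm
  for sm :: "'f::{real_normed_field, banach} \<Rightarrow> 'a::banach \<Rightarrow> 'a" +
  fixes x :: "nat \<Rightarrow> 'a" and x' :: "nat \<Rightarrow> 'a \<Rightarrow> 'f"
  assumes basis: "is_basis sm x x'"
    and symmetric: "one_symmetric sm x"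
begin

definition mean :: "nat set \<Rightarrow> 'a" where
  "mean D = sm (inverse (of_nat (card D))) (\<Sum>i\<in>D. x i)"

abbreviation comb :: "(nat \<Rightarrow> 'f) \<Rightarrow> nat set \<Rightarrow> 'a" where
  "comb a I \<equiv> \<Sum>i\<in>I. sm (a i) (x i)"

lemma mean_eq_comb: "mean D = comb (\<lambda>_. inverse (of_nat (card D))) D"
  by (simp add: mean_def scale_sum_right)

text \<open>
  The inequality that defines symmetry, applied to the inverse permutation, yields the reverse
  inequality.
\<close>

lemma norm_comb_permute:
  assumes "finite I" "bij \<pi>"
  shows "norm (\<Sum>i\<in>I. sm (a i) (x (\<pi> i))) = norm (comb a I)"
proof -
  have le: "norm (comb b J) \<le> norm (\<Sum>i\<in>J. sm (b i) (x (\<rho> i)))"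
    if J: "finite J" and \<rho>: "bij \<rho>" for b J \<rho>
  proof -
    define b' where "b' = (\<lambda>i. if i \<in> J then b i else 0)"
    have sub: "{i. b' i \<noteq> 0} \<subseteq> J" by (auto simp: b'_def split: if_splits)
    have eq: "(\<Sum>i | b' i \<noteq> 0. sm (b' i) (y i)) = (\<Sum>i\<in>J. sm (b i) (y i))" for y
    proof -
      have "(\<Sum>i | b' i \<noteq> 0. sm (b' i) (y i)) = (\<Sum>i\<in>J. sm (b' i) (y i))"
        using J sub by (intro sum.mono_neutral_left) auto
      then show ?thesis by (simp add: b'_def)
    qed
    have "finite {i. b' i \<noteq> 0}" using J sub finite_subset by blast
    then have "norm (\<Sum>i | b' i \<noteq> 0. sm (b' i) (x i))
        \<le> norm (\<Sum>i | b' i \<noteq> 0. sm (b' i) (x (\<rho> i)))"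
      using symmetric \<rho> unfolding one_symmetric_def by blast
    then show ?thesis
      using eq[of x] eq[of "\<lambda>i. x (\<rho> i)"] by simp
  qed
  have inj: "inj_on \<pi> I" using assms(2) by (meson bij_is_inj inj_on_subset subset_UNIV)
  have "comb (\<lambda>j. a (inv \<pi> j)) (\<pi> ` I) = (\<Sum>i\<in>I. sm (a i) (x (\<pi> i)))"
    using assms(2) by (subst sum.reindex[OF inj]) (simp add: bij_is_inj)
  moreover have "(\<Sum>j\<in>\<pi> ` I. sm (a (inv \<pi> j)) (x (inv \<pi> j))) = comb a I"
    using assms(2) by (subst sum.reindex[OF inj]) (simp add: bij_is_inj)
  ultimately show ?thesis
    using le[OF assms, of a] le[of "\<pi> ` I" "inv \<pi>" "\<lambda>j. a (inv \<pi> j)"] assms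
    by (simp add: bij_imp_bij_inv)
qed

lemma norm_comb_inj:
  assumes "finite I" "inj_on \<sigma> I"
  shows "norm (\<Sum>i\<in>I. sm (a i) (x (\<sigma> i))) = norm (comb a I)"
proof -
  obtain \<pi> where \<pi>: "bij \<pi>" "\<forall>i\<in>I. \<pi> i = \<sigma> i"
    using inj_on_finite_extends_to_bij[OF assms] .
  then have "(\<Sum>i\<in>I. sm (a i) (x (\<sigma> i))) = (\<Sum>i\<in>I. sm (a i) (x (\<pi> i)))"
    by (intro sum.cong) auto
  then show ?thesis using norm_comb_permute[OF assms(1) \<pi>(1)] by simp
qed

text \<open>
  The triangle inequality for an average over rearrangements, multiplied by their number.
\<close>

lemma norm_sum_placements_le:
  assumes "finite I" "finite K" "\<And>k. k \<in> K \<Longrightarrow> inj_on (\<sigma> k) I"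
  shows "norm (\<Sum>i\<in>I. sm (a i) (\<Sum>k\<in>K. x (\<sigma> k i))) \<le> real (card K) * norm (comb a I)"
proof -
  have "(\<Sum>i\<in>I. sm (a i) (\<Sum>k\<in>K. x (\<sigma> k i))) = (\<Sum>k\<in>K. \<Sum>i\<in>I. sm (a i) (x (\<sigma> k i)))"
    unfolding scale_sum_right by (rule sum.swap)
  also have "norm \<dots> \<le> (\<Sum>k\<in>K. norm (\<Sum>i\<in>I. sm (a i) (x (\<sigma> k i))))"
    by (rule norm_sum)
  also have "\<dots> = (\<Sum>k\<in>K. norm (comb a I))"
    using norm_comb_inj[OF assms(1) assms(3)] by (intro sum.cong refl)
  finally show ?thesis by simp
qed

text \<open>
  Average over all pairs of a cyclic placement of \<open>A\<close> in \<open>D\<close> and a cyclic placement of \<open>B\<close> in \<open>E\<close>, while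
  \<open>R\<close> stays in place. The disjointness of the targets makes each such pair a rearrangement of the
  vector on the right-hand side, and each index of \<open>A\<close> is spread evenly over \<open>D\<close>.
  Using pairs of placements permits targets of different cardinalities.
\<close>

lemma norm_average_two_blocks_le:
  assumes fin: "finite R" "finite A" "finite B" "finite D" "finite E"
    and source: "R \<inter> A = {}" "R \<inter> B = {}" "A \<inter> B = {}"
    and target: "R \<inter> D = {}" "R \<inter> E = {}" "D \<inter> E = {}"
    and card: "card A \<le> card D" "card B \<le> card E" "D \<noteq> {}" "E \<noteq> {}"
  shows "norm (comb a R + sm (\<Sum>i\<in>A. a i) (mean D) + sm (\<Sum>i\<in>B. a i) (mean E))
    \<le> norm (comb a (R \<union> A \<union> B))"
proof -
  let ?M = "card D" and ?N = "card E"
  obtain \<tau> where \<tau>: "\<forall>k. inj_on (\<tau> k) A" "\<forall>k. \<tau> k ` A \<subseteq> D"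
    "\<forall>i\<in>A. bij_betw (\<lambda>k. \<tau> k i) {..<?M} D"
    using obtain_cyclic_placements[OF fin(2,4) card(1)] .
  obtain \<upsilon> where \<upsilon>: "\<forall>k. inj_on (\<upsilon> k) B" "\<forall>k. \<upsilon> k ` B \<subseteq> E"
    "\<forall>i\<in>B. bij_betw (\<lambda>k. \<upsilon> k i) {..<?N} E"
    using obtain_cyclic_placements[OF fin(3,5) card(2)] .
  define \<sigma> where
    "\<sigma> = (\<lambda>(k, l) i. if i \<in> A then \<tau> k i else if i \<in> B then \<upsilon> l i else i)"
  define K where "K = {..<?M} \<times> {..<?N}"
  \<comment> \<open>The number of placements as a scalar; all sums below are \<open>c\<close> times an average.\<close>
  define c :: 'f where "c = of_nat (card K)"
  have c: "c = of_nat ?M * of_nat ?N" and c0: "c \<noteq> 0"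
    using fin card by (auto simp: c_def K_def card_cartesian_product)
  have inj: "inj_on (\<sigma> p) (R \<union> A \<union> B)" for p
  proof (cases p)
    case (Pair k l)
    have eqs: "\<sigma> p i = \<tau> k i" if "i \<in> A" for i using that by (simp add: \<sigma>_def Pair)
    have eqs2: "\<sigma> p i = \<upsilon> l i" if "i \<in> B" for i using that source by (auto simp: \<sigma>_def Pair)
    have eqs3: "\<sigma> p i = i" if "i \<in> R" for i using that source by (auto simp: \<sigma>_def Pair)
    have inj: "inj_on (\<sigma> p) A" "inj_on (\<sigma> p) B" "inj_on (\<sigma> p) R"
      using \<tau>(1) \<upsilon>(1) eqs eqs2 eqs3 by (auto simp: inj_on_def)
    have "\<sigma> p ` A \<subseteq> D" "\<sigma> p ` B \<subseteq> E" "\<sigma> p ` R \<subseteq> R"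
      using \<tau>(2) \<upsilon>(2) eqs eqs2 eqs3 by auto
    moreover have "R \<inter> D = {}" "R \<inter> E = {}" "D \<inter> E = {}" by fact+
    ultimately have "\<sigma> p ` (R - A) \<inter> \<sigma> p ` (A - R) = {}"
      "\<sigma> p ` (R \<union> A - B) \<inter> \<sigma> p ` (B - (R \<union> A)) = {}"
      by blast+
    then show ?thesis
      using inj by (simp add: inj_on_Un)
  qed
  have sumR: "(\<Sum>p\<in>K. x (\<sigma> p i)) = sm c (x i)" if "i \<in> R" for i
  proof -
    have "(\<Sum>p\<in>K. x (\<sigma> p i)) = (\<Sum>p\<in>K. x i)"
      using that source by (intro sum.cong) (auto simp: \<sigma>_def)
    also have "\<dots> = sm c (x i)"
      by (simp add: sum_constant_scale c_def)
    finally show ?thesis .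
  qed
  have sumA: "(\<Sum>p\<in>K. x (\<sigma> p i)) = sm c (mean D)" if "i \<in> A" for i
  proof -
    have "(\<Sum>p\<in>K. x (\<sigma> p i)) = (\<Sum>k<?M. \<Sum>l<?N. x (\<tau> k i))"
      using that unfolding K_def sum.cartesian_product by (intro sum.cong) (auto simp: \<sigma>_def)
    also have "\<dots> = (\<Sum>k<?M. sm (of_nat ?N) (x (\<tau> k i)))"
      by (simp add: sum_constant_scale)
    also have "\<dots> = sm (of_nat ?N) (\<Sum>d\<in>D. x d)"
      unfolding scale_sum_right[symmetric]
      by (simp add: sum.reindex_bij_betw[OF \<tau>(3)[rule_format, OF that]])
    also have "\<dots> = sm c (mean D)"
      using card fin by (simp add: mean_def c)
    finally show ?thesis .
  qed
  have sumB: "(\<Sum>p\<in>K. x (\<sigma> p i)) = sm c (mean E)" if "i \<in> B" for i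
  proof -
    have "(\<Sum>p\<in>K. x (\<sigma> p i)) = (\<Sum>k<?M. \<Sum>l<?N. x (\<upsilon> l i))"
      using that source unfolding K_def sum.cartesian_product
      by (intro sum.cong) (auto simp: \<sigma>_def)
    also have "\<dots> = sm (of_nat ?M) (\<Sum>d\<in>E. x d)"
      by (simp add: sum_constant_scale sum.reindex_bij_betw[OF \<upsilon>(3)[rule_format, OF that]])
    also have "\<dots> = sm c (mean E)"
      using card fin by (simp add: mean_def c)
    finally show ?thesis .
  qed
  have "(\<Sum>i\<in>R \<union> A \<union> B. sm (a i) (\<Sum>p\<in>K. x (\<sigma> p i)))
      = (\<Sum>i\<in>R. sm (a i) (sm c (x i))) + (\<Sum>i\<in>A. sm (a i) (sm c (mean D)))
        + (\<Sum>i\<in>B. sm (a i) (sm c (mean E)))"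
  proof -
    have "(R \<union> A) \<inter> B = {}" using source by blast
    then show ?thesis
      using fin source(1) by (simp add: sum.union_disjoint sumR sumA sumB)
  qed
  also have "\<dots> = sm c (comb a R + sm (\<Sum>i\<in>A. a i) (mean D) + sm (\<Sum>i\<in>B. a i) (mean E))"
    by (simp add: scale_right_distrib scale_sum_right scale_sum_left mult.commute)
  finally have "norm (sm c (comb a R + sm (\<Sum>i\<in>A. a i) (mean D) + sm (\<Sum>i\<in>B. a i) (mean E)))
      \<le> real (card K) * norm (comb a (R \<union> A \<union> B))"
    using norm_sum_placements_le[of "R \<union> A \<union> B" K \<sigma> a] fin inj by (simp add: K_def)
  then show ?thesis
    using c0 by (simp add: norm_scale c_def)
qed

end

section \<open>Functionals on dense subspaces and weak-star closures\<close>

text \<open>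
  A functional that is bounded on \<open>V\<close> is Lipschitz and so extends continuously to the closure of \<open>V\<close>.
  Linearity and the bound are closed conditions and therefore pass from \<open>V\<close> to the whole space.
\<close>

lemma dual_space_extension:
  fixes sm :: "'f::{real_normed_field, banach} \<Rightarrow> 'a::real_normed_vector \<Rightarrow> 'a"
  assumes "normed_space_over sm"
    and V: "module.subspace sm V" "closure V = UNIV"
    and add: "\<And>u v. u \<in> V \<Longrightarrow> v \<in> V \<Longrightarrow> s (u + v) = s u + s v"
    and scale: "\<And>c v. v \<in> V \<Longrightarrow> s (sm c v) = c * s v"
    and bound: "\<And>v. v \<in> V \<Longrightarrow> norm (s v) \<le> K * norm v"
    and K: "0 \<le> K"
  obtains g where "g \<in> dual_space sm" "\<forall>v\<in>V. g v = s v"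
proof -
  interpret normed_space_over sm by fact
  note V_add = subspace_add[OF V(1)] and V_scale = subspace_scale[OF V(1)]
  have diff: "s (u - v) = s u - s v" if "u \<in> V" "v \<in> V" for u v
    using add[of "u - v" v] subspace_diff[OF V(1)] that by simp
  have "K-lipschitz_on V s"
    using K bound subspace_diff[OF V(1)] by (intro lipschitz_onI) (auto simp: dist_norm diff[symmetric])
  then obtain g where gK: "K-lipschitz_on UNIV g" and gs: "\<forall>v\<in>V. g v = s v"
    using lipschitz_extend_closure[of K V s] V(2) by auto
  have cont: "continuous_on A g" for A
    using lipschitz_on_continuous_on[OF gK] continuous_on_subset by blast
  have dense: "P v" if "closed {v. P v}" "\<And>v. v \<in> V \<Longrightarrow> P v" for P :: "'a \<Rightarrow> bool" and v
    using closure_minimal[of V "{v. P v}"] that V(2) by auto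
  have cont_shift: "continuous_on UNIV (\<lambda>u. g (u + w))" for w
    by (rule continuous_on_compose2[OF cont[of UNIV]]) (auto intro!: continuous_intros)
  \<comment> \<open>Additivity passes to the closure in one argument at a time.\<close>
  have g_add1: "g (v + w) = g v + g w" if "w \<in> V" for v w
  proof (rule dense[of "\<lambda>v. g (v + w) = g v + g w"])
    show "closed {v. g (v + w) = g v + g w}"
      by (intro closed_Collect_eq cont_shift continuous_intros cont)
  qed (use that V_add gs add in auto)
  have g_add: "g (v + w) = g v + g w" for v w
  proof (rule dense[of "\<lambda>w. g (v + w) = g v + g w"])
    show "closed {w. g (v + w) = g v + g w}"
      using cont_shift[of v] by (intro closed_Collect_eq) (auto simp: add.commute intro!: continuous_intros cont)
  qed (use g_add1 in auto)
  have "bounded_linear (sm c)" for c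
  proof (rule bounded_linear_intro[where K = "norm c"])
    show "sm c (r *\<^sub>R v) = r *\<^sub>R sm c v" for r v
      by (simp add: scale_of_real[symmetric] mult.commute)
  qed (auto simp: scale_right_distrib norm_scale mult.commute)
  then have cont_sm: "continuous_on UNIV (sm c)" for c
    using linear_continuous_on by blast
  have g_scale: "g (sm c v) = c * g v" for c v
  proof (rule dense[of "\<lambda>v. g (sm c v) = c * g v"])
    have "continuous_on UNIV (\<lambda>v. g (sm c v))"
      by (rule continuous_on_compose2[OF cont[of UNIV] cont_sm]) auto
    then show "closed {v. g (sm c v) = c * g v}"
      by (intro closed_Collect_eq continuous_intros cont)
  qed (use V_scale gs scale in auto)
  have g_bound: "norm (g v) \<le> norm v * K" for v
  proof (rule dense[of "\<lambda>v. norm (g v) \<le> norm v * K"])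
    show "closed {v. norm (g v) \<le> norm v * K}"
      by (intro closed_Collect_le continuous_intros cont)
  qed (use gs bound in \<open>auto simp: mult.commute\<close>)
  have "bounded_linear g"
  proof (rule bounded_linear_intro[OF g_add _ g_bound])
    show "g (r *\<^sub>R v) = r *\<^sub>R g v" for r v
      using g_scale[of "of_real r" v] by (simp add: scale_of_real scaleR_conv_of_real)
  qed
  moreover have "Vector_Spaces.linear sm (*) g"
    unfolding Vector_Spaces.linear_iff
    using vector_space_axioms g_add g_scale
    by (auto simp: vector_space_def algebra_simps)
  ultimately show ?thesis using that gs by (auto simp: dual_space_def)
qed

text \<open>
  Evaluation at \<open>y\<close> is continuous for pointwise convergence, so the functionals that vanish at \<open>y\<close> form a
  closed subspace.
\<close>

lemma vanish_on_weak_star_closure: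
  fixes sm :: "'f::real_normed_field \<Rightarrow> 'a::real_normed_vector \<Rightarrow> 'a"
  assumes "g \<in> weak_star_topology sm closure_of module.span (\<lambda>c f v. c * f v) F"
    and "\<And>f. f \<in> F \<Longrightarrow> f y = 0"
  shows "g y = 0"
proof -
  interpret scalar_functions: module "\<lambda>(c::'f) (f::'a \<Rightarrow> 'f) v. c * f v"
    by unfold_locales (auto simp: algebra_simps)
  have "scalar_functions.subspace {f. f y = 0}" by (auto simp: scalar_functions.subspace_def)
  then have "scalar_functions.span F \<subseteq> {f. f y = 0}"
    using assms(2) by (intro scalar_functions.span_minimal) auto
  moreover have "closed {f :: 'a \<Rightarrow> 'f. f y = 0}"
    by (intro closed_Collect_eq continuous_on_product_coordinates continuous_on_const)
  ultimately have "closure (scalar_functions.span F) \<subseteq> {f. f y = 0}"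
    by (rule closure_minimal)
  moreover have "g \<in> closure (scalar_functions.span F)"
    using assms(1) closure_of_subtopology_subset[of euclidean]
    by (auto simp: weak_star_topology_def euclidean_closure_of)
  ultimately show ?thesis by auto
qed

section \<open>Coordinates\<close>

context symmetric_basis
begin

lemma coord_add: "x' n (u + v) = x' n u + x' n v"
  and coord_scale: "x' n (sm c v) = c * x' n v"
  and coord_bounded_linear: "bounded_linear (x' n)"
  and coord_basis: "x' n (x m) = (if n = m then 1 else 0)"
  using basis unfolding is_basis_def dual_space_def Vector_Spaces.linear_iff by auto

lemma coord_zero: "x' n 0 = 0"
  using coord_bounded_linear linear_simps(3) by blast

lemma coord_sum: "x' n (\<Sum>i\<in>I. f i) = (\<Sum>i\<in>I. x' n (f i))"
  by (rule linear_sum[OF bounded_linear.linear[OF coord_bounded_linear]])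

lemma coord_comb: "finite I \<Longrightarrow> x' n (comb a I) = (if n \<in> I then a n else 0)"
  by (simp add: coord_sum coord_scale coord_basis if_distrib[of "(*) _"] sum.delta cong: if_cong)

lemma span_obtain_coords:
  assumes "v \<in> span (range x)"
  obtains N where "\<forall>i\<ge>N. x' i v = 0" "v = comb (\<lambda>i. x' i v) {..<N}"
proof -
  define P where "P = (\<lambda>v. \<exists>N. (\<forall>i\<ge>N. x' i v = 0) \<and> v = comb (\<lambda>i. x' i v) {..<N})"
  have "P v"
    using assms
  proof (induction rule: span_induct_alt)
    case base
    show ?case by (auto simp: P_def coord_zero intro: exI[of _ 0])
  next
    case (step c u v)
    then obtain m where m: "u = x m" by auto
    obtain N where N: "\<forall>i\<ge>N. x' i v = 0" "v = comb (\<lambda>i. x' i v) {..<N}"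
      using step by (auto simp: P_def)
    define M where "M = max N (Suc m)"
    have "comb (\<lambda>i. x' i v) {..<M} = comb (\<lambda>i. x' i v) {..<N}"
      using N(1) by (intro sum.mono_neutral_right) (auto simp: M_def)
    moreover have "comb (\<lambda>i. c * x' i u) {..<M} = sm c u"
    proof -
      have "comb (\<lambda>i. c * x' i u) {..<M} = (\<Sum>i<M. if i = m then sm c (x m) else 0)"
        by (intro sum.cong) (auto simp: m coord_basis)
      then show ?thesis by (simp add: m M_def sum.delta less_max_iff_disj)
    qed
    ultimately have "sm c u + v = comb (\<lambda>i. x' i (sm c u + v)) {..<M}"
      using N(2) by (simp add: coord_add coord_scale scale_left_distrib sum.distrib)
    moreover have "\<forall>i\<ge>M. x' i (sm c u + v) = 0"
      using N(1) by (auto simp: M_def coord_add coord_scale m coord_basis)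
    ultimately show ?case unfolding P_def by blast
  qed
  then show ?thesis using that by (auto simp: P_def)
qed

lemma dense_span: "closure (span (range x)) = UNIV"
  using basis by (simp add: is_basis_def)

section \<open>Small means force suppression unconditionality\<close>

lemma norm_average_block_le:
  assumes "finite R" "finite A" "finite D" "R \<inter> A = {}" "R \<inter> D = {}"
    "card A \<le> card D" "D \<noteq> {}"
  shows "norm (comb a R + sm (\<Sum>i\<in>A. a i) (mean D)) \<le> norm (comb a (R \<union> A))"
proof -
  obtain E :: "nat set" where E: "finite E" "card E = 1" "E \<inter> (R \<union> D) = {}"
    using obtain_disjoint_set_of_card[of "R \<union> D" 1] assms by auto
  then show ?thesis
    using norm_average_two_blocks_le[of R A "{}" D E a] assms by fastforce
qed

text \<open>
  Averaging the mean of \<open>D\<close> over placements in \<open>E\<close> gives the mean of \<open>E\<close>, as the coefficients of a mean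
  add up to \<open>1\<close>. The same reason applies to differences of means.
\<close>

lemma norm_mean_antimono:
  assumes "finite D" "D \<noteq> {}" "finite E" "card D \<le> card E"
  shows "norm (mean E) \<le> norm (mean D)"
proof -
  have "E \<noteq> {}" using assms by auto
  then show ?thesis
    using norm_average_block_le[of "{}" D E "\<lambda>_. inverse (of_nat (card D))"] assms
    by (simp add: mean_eq_comb[symmetric])
qed

lemma norm_mean_diff_antimono:
  assumes "finite A" "A \<noteq> {}" "finite B" "B \<noteq> {}" "A \<inter> B = {}"
    and "finite D" "card A \<le> card D" "finite E" "card B \<le> card E" "D \<inter> E = {}"
  shows "norm (mean D - mean E) \<le> norm (mean A - mean B)"
proof -
  define a :: "nat \<Rightarrow> 'f" where
    "a = (\<lambda>i. if i \<in> A then inverse (of_nat (card A)) else - inverse (of_nat (card B)))"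
  have aA: "i \<in> A \<Longrightarrow> a i = inverse (of_nat (card A))" for i by (simp add: a_def)
  have aB: "i \<in> B \<Longrightarrow> a i = - inverse (of_nat (card B))" for i
    using assms by (auto simp: a_def)
  have "comb a (A \<union> B) = mean A - mean B"
    using assms by (simp add: sum.union_disjoint aA aB mean_eq_comb sum_negf)
  moreover have "(\<Sum>i\<in>A. a i) = 1" "(\<Sum>i\<in>B. a i) = - 1"
    using assms by (simp_all add: aA aB)
  moreover have "D \<noteq> {}" "E \<noteq> {}" using assms by auto
  ultimately show ?thesis
    using norm_average_two_blocks_le[of "{}" A B D E a] assms by simp
qed

text \<open>
  Averaging the block \<open>B\<close> over a set with a small mean makes its contribution less than any given \<open>e\<close>;
  since the norm of the mean does not increase with the cardinality, the set can be chosen large enough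
  for \<open>B\<close> and disjoint from \<open>R\<close>. So coordinate projections are contractive on the span, and by continuity
  of the coordinates on the whole space.
\<close>

lemma small_means_imp_suppression:
  assumes small: "\<And>e. 0 < e \<Longrightarrow> \<exists>D. finite D \<and> D \<noteq> {} \<and> norm (mean D) < e"
  shows "one_suppression_unconditional sm x x'"
  unfolding one_suppression_unconditional_def
proof (intro allI impI)
  fix A v assume A: "finite (A :: nat set)"
  have fin: "norm (comb a R) \<le> norm (comb a (R \<union> B))"
    if RB: "finite R" "finite B" "R \<inter> B = {}" for a R B
  proof (rule field_le_epsilon)
    fix e :: real assume e: "0 < e"
    define s where "s = (\<Sum>i\<in>B. a i)"
    \<comment> \<open>The \<open>1\<close> in the denominator avoids a case distinction on \<open>s = 0\<close>.\<close>
    have "0 < e / (1 + norm s)" using e by (simp add: add_pos_nonneg)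
    from small[OF this] obtain D where D: "finite D" "D \<noteq> {}"
      "norm (mean D) < e / (1 + norm s)" by blast
    obtain E where E: "finite E" "card E = card D + card B" "E \<inter> R = {}"
      using obtain_disjoint_set_of_card[OF RB(1)] .
    have "E \<noteq> {}" using E D by auto
    then have *: "norm (comb a R + sm s (mean E)) \<le> norm (comb a (R \<union> B))"
      unfolding s_def using RB E by (intro norm_average_block_le) auto
    have "norm (mean E) \<le> norm (mean D)" using D E by (intro norm_mean_antimono) auto
    then have "norm s * norm (mean E) \<le> (1 + norm s) * (e / (1 + norm s))"
      using D(3) by (intro mult_mono) auto
    also have "\<dots> = e" by (simp add: add_nonneg_eq_0_iff)
    finally have "norm (sm s (mean E)) \<le> e" by (simp add: norm_scale)
    then show "norm (comb a R) \<le> norm (comb a (R \<union> B)) + e"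
      using * norm_triangle_ineq4[of "comb a R + sm s (mean E)" "sm s (mean E)"] by simp
  qed
  have on_span: "norm (\<Sum>n\<in>A. sm (x' n v) (x n)) \<le> norm v" if v: "v \<in> span (range x)" for v
  proof -
    obtain N where N: "\<forall>i\<ge>N. x' i v = 0" "v = comb (\<lambda>i. x' i v) {..<N}"
      using span_obtain_coords[OF v] .
    have "(\<Sum>n\<in>A. sm (x' n v) (x n)) = comb (\<lambda>i. x' i v) (A \<inter> {..<N})"
      using A N(1) by (intro sum.mono_neutral_right) (auto simp: not_less)
    also have "norm \<dots> \<le> norm (comb (\<lambda>i. x' i v) (A \<inter> {..<N} \<union> ({..<N} - A)))"
      using A by (intro fin) auto
    also have "A \<inter> {..<N} \<union> ({..<N} - A) = {..<N}" by blast
    finally show ?thesis using N(2) by simp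
  qed
  have "bounded_linear (\<lambda>c. sm c (x n))" for n
  proof (rule bounded_linear_intro[where K = "norm (x n)"])
    show "sm (r *\<^sub>R c) (x n) = r *\<^sub>R sm c (x n)" for r c
      by (simp add: scale_of_real[symmetric] scaleR_conv_of_real)
  qed (auto simp: scale_left_distrib norm_scale)
  then have "continuous_on UNIV (\<lambda>v. sm (x' n v) (x n))" for n
    using bounded_linear_compose[OF _ coord_bounded_linear] linear_continuous_on by blast
  then have "closed {v. norm (\<Sum>n\<in>A. sm (x' n v) (x n)) \<le> norm v}"
    by (intro closed_Collect_le continuous_intros)
  then have "closure (span (range x)) \<subseteq> {v. norm (\<Sum>n\<in>A. sm (x' n v) (x n)) \<le> norm v}"
    using on_span by (intro closure_minimal) auto
  then show "norm (\<Sum>n\<in>A. sm (x' n v) (x n)) \<le> norm v"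
    unfolding dense_span by auto
qed

section \<open>The summation functional and the separation of means\<close>

lemma norm_sum_coeffs_le:
  assumes d: "0 < d" "\<And>D. finite D \<Longrightarrow> D \<noteq> {} \<Longrightarrow> d \<le> norm (mean D)" and "finite I"
  shows "norm (\<Sum>i\<in>I. a i) \<le> inverse d * norm (comb a I)"
proof (cases "I = {}")
  case False
  have "norm (\<Sum>i\<in>I. a i) * d \<le> norm (\<Sum>i\<in>I. a i) * norm (mean I)"
    using d(2)[OF assms(3) False] by (intro mult_left_mono) auto
  also have "\<dots> \<le> norm (comb a I)"
    using norm_average_block_le[of "{}" I I a] False assms(3) by (simp add: norm_scale)
  finally show ?thesis using d(1) by (simp add: field_simps)
qed simp

text \<open>
  On the span the sum of the coordinates is a finite sum, and it is bounded by
  \<open>norm_sum_coeffs_le\<close>; density of the span gives the extension.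
\<close>

lemma summation_functional:
  assumes d: "0 < d" "\<And>D. finite D \<Longrightarrow> D \<noteq> {} \<Longrightarrow> d \<le> norm (mean D)"
  obtains S where "S \<in> dual_space sm" "\<forall>n. S (x n) = 1"
proof -
  define s where "s v = (\<Sum>i | x' i v \<noteq> 0. x' i v)" for v
  have s_eq: "\<exists>N. \<forall>n\<ge>N. s v = (\<Sum>i<n. x' i v) \<and> v = comb (\<lambda>i. x' i v) {..<n}"
    if v: "v \<in> span (range x)" for v
  proof -
    obtain N where N: "\<forall>i\<ge>N. x' i v = 0" "v = comb (\<lambda>i. x' i v) {..<N}"
      using span_obtain_coords[OF v] .
    have "s v = (\<Sum>i<n. x' i v)" if "N \<le> n" for n
      unfolding s_def using N(1) that by (intro sum.mono_neutral_left) (auto simp: not_le[symmetric])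
    moreover have "comb (\<lambda>i. x' i v) {..<n} = comb (\<lambda>i. x' i v) {..<N}" if "N \<le> n" for n
      using N(1) that by (intro sum.mono_neutral_right) auto
    ultimately show ?thesis using N(2) by (intro exI[of _ N]) metis
  qed
  have add: "s (u + v) = s u + s v" if uv: "u \<in> span (range x)" "v \<in> span (range x)" for u v
  proof -
    obtain N1 N2 N3 where N: "\<forall>n\<ge>N1. s u = (\<Sum>i<n. x' i u)"
      "\<forall>n\<ge>N2. s v = (\<Sum>i<n. x' i v)" "\<forall>n\<ge>N3. s (u + v) = (\<Sum>i<n. x' i (u + v))"
      using s_eq[OF uv(1)] s_eq[OF uv(2)] s_eq[OF span_add[OF uv]] by blast
    define n where "n = N1 + N2 + N3"
    have "s u = (\<Sum>i<n. x' i u)" "s v = (\<Sum>i<n. x' i v)" "s (u + v) = (\<Sum>i<n. x' i (u + v))"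
      using N by (simp_all add: n_def)
    then show ?thesis by (simp add: coord_add sum.distrib)
  qed
  have scale: "s (sm c v) = c * s v" if v: "v \<in> span (range x)" for c v
  proof -
    obtain N1 N2 where N: "\<forall>n\<ge>N1. s v = (\<Sum>i<n. x' i v)"
      "\<forall>n\<ge>N2. s (sm c v) = (\<Sum>i<n. x' i (sm c v))"
      using s_eq[OF v] s_eq[OF span_scale[OF v]] by blast
    show ?thesis
      using N(1)[rule_format, of "N1 + N2"] N(2)[rule_format, of "N1 + N2"]
      by (simp add: coord_scale sum_distrib_left)
  qed
  have bound: "norm (s v) \<le> inverse d * norm v" if v: "v \<in> span (range x)" for v
  proof -
    obtain n where n: "s v = (\<Sum>i<n. x' i v)" "v = comb (\<lambda>i. x' i v) {..<n}"
      using s_eq[OF v] by blast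
    then show ?thesis
      using norm_sum_coeffs_le[OF d, of "{..<n}" "\<lambda>i. x' i v"] by simp
  qed
  obtain S where S: "S \<in> dual_space sm" "\<forall>v\<in>span (range x). S v = s v"
    using dual_space_extension[OF normed_space_over_axioms subspace_span dense_span add scale bound] d(1)
    by auto
  have "s (x n) = 1" for n
  proof -
    have "{i. x' i (x n) \<noteq> 0} = {n}" by (auto simp: coord_basis)
    then show ?thesis by (simp add: s_def coord_basis)
  qed
  then show ?thesis using that S span_base by fastforce
qed

text \<open>
  Totality excludes a nonzero vector all of whose coordinates vanish. If two disjoint means are close,
  then so are all disjoint means over sets that are large enough; comparing two overlapping initial
  segments with a third set \<open>E\<close> disjoint from both shows that the means over initial segments form a
  Cauchy sequence. Its limit would be such a vector, since the summation functional takes the value \<open>1\<close>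
  there.
\<close>

lemma means_separated:
  assumes total: "total_basis sm x x'"
    and d: "0 < d" "\<And>D. finite D \<Longrightarrow> D \<noteq> {} \<Longrightarrow> d \<le> norm (mean D)"
  shows "\<exists>e>0. \<forall>A B. finite A \<longrightarrow> A \<noteq> {} \<longrightarrow> finite B \<longrightarrow> B \<noteq> {} \<longrightarrow> A \<inter> B = {} \<longrightarrow>
    e \<le> norm (mean A - mean B)"
proof (rule ccontr)
  assume contra: "\<not> ?thesis"
  have close: "\<exists>A B. finite A \<and> A \<noteq> {} \<and> finite B \<and> B \<noteq> {} \<and> A \<inter> B = {} \<and>
      norm (mean A - mean B) < e" if "0 < e" for e
  proof -
    have "\<not> (\<forall>A B. finite A \<longrightarrow> A \<noteq> {} \<longrightarrow> finite B \<longrightarrow> B \<noteq> {} \<longrightarrow> A \<inter> B = {} \<longrightarrow>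
        e \<le> norm (mean A - mean B))"
      using contra that by blast
    then show ?thesis by (simp add: not_le)
  qed
  define u where "u n = mean {..<Suc n}" for n
  have "Cauchy u"
  proof (rule CauchyI)
    fix e :: real assume "0 < e"
    then obtain A B where AB: "finite A" "A \<noteq> {}" "finite B" "B \<noteq> {}" "A \<inter> B = {}"
      "norm (mean A - mean B) < e / 2"
      using close[of "e / 2"] by auto
    define N where "N = card A + card B"
    have "norm (u m - u n) < e" if mn: "N \<le> m" "N \<le> n" for m n
    proof -
      obtain E where E: "finite E" "card E = N" "E \<inter> ({..<Suc m} \<union> {..<Suc n}) = {}"
        using obtain_disjoint_set_of_card[of "{..<Suc m} \<union> {..<Suc n}" N] by auto
      have "norm (u k - mean E) < e / 2" if "k = m \<or> k = n" for k
        unfolding u_def using that mn E AB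
        by (intro order.strict_trans1[OF norm_mean_diff_antimono AB(6)]) (auto simp: N_def)
      from this[of m] this[of n] show ?thesis
        using norm_triangle_ineq4[of "u m - mean E" "u n - mean E"] by simp
    qed
    then show "\<exists>N. \<forall>m\<ge>N. \<forall>n\<ge>N. norm (u m - u n) < e" by blast
  qed
  then obtain y where y: "u \<longlonglongrightarrow> y"
    using Cauchy_convergent convergent_def by blast
  \<comment> \<open>The \<open>i\<close>-th coordinate of a mean over \<open>n + 1 > i\<close> indices is \<open>1 / (n + 1)\<close>.\<close>
  have "x' i y = 0" for i
  proof -
    have "(\<lambda>n. inverse (of_nat (Suc n)) :: 'f) \<longlonglongrightarrow> 0"
      using lim_inverse_n[where 'a = 'f] by (rule LIMSEQ_Suc)
    moreover have "\<forall>\<^sub>F n in sequentially. inverse (of_nat (Suc n)) = x' i (u n)"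
      using eventually_ge_at_top[of i]
      by eventually_elim (simp add: u_def mean_eq_comb coord_comb del: sum.lessThan_Suc)
    ultimately have "(\<lambda>n. x' i (u n)) \<longlonglongrightarrow> 0"
      by (rule Lim_transform_eventually)
    moreover have "(\<lambda>n. x' i (u n)) \<longlonglongrightarrow> x' i y"
      using bounded_linear.tendsto[OF coord_bounded_linear y] .
    ultimately show ?thesis using LIMSEQ_unique by blast
  qed
  moreover obtain S where S: "S \<in> dual_space sm" "\<forall>n. S (x n) = 1"
    using summation_functional[OF d] .
  ultimately have "S y = 0"
    using vanish_on_weak_star_closure[of S sm "range x'" y] total
    unfolding total_basis_def by auto
  moreover have "S (u n) = 1" for n
  proof -
    have lin: "bounded_linear S" and hom: "S (sm c v) = c * S v" for c v
      using S(1) unfolding dual_space_def Vector_Spaces.linear_iff by auto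
    show ?thesis
      unfolding u_def mean_eq_comb linear_sum[OF bounded_linear.linear[OF lin]]
      by (simp add: hom S(2) del: of_nat_Suc sum.lessThan_Suc)
  qed
  moreover have "(\<lambda>n. S (u n)) \<longlonglongrightarrow> S y"
    using S(1) bounded_linear.tendsto[OF _ y] by (auto simp: dual_space_def)
  ultimately show False by (simp add: LIMSEQ_const_iff)
qed

section \<open>The estimates for the sum of the absolute values\<close>

text \<open>
  With \<open>s\<close> and \<open>t\<close> the coefficient sums over \<open>A\<close> and its complement in \<open>I\<close>, place these two blocks on
  disjoint sets \<open>D\<close>, \<open>E\<close> in both orders. The difference of the two averages is
  \<open>s - t\<close> times the difference of the means of \<open>D\<close> and \<open>E\<close>, which bounds \<open>s - t\<close>; the summation functional
  bounds \<open>s + t\<close>.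
\<close>

lemma norm_partial_sum_coeffs_le:
  assumes d: "0 < d" "\<And>D. finite D \<Longrightarrow> D \<noteq> {} \<Longrightarrow> d \<le> norm (mean D)"
    and e: "0 < e" "\<And>A B. finite A \<Longrightarrow> A \<noteq> {} \<Longrightarrow> finite B \<Longrightarrow> B \<noteq> {} \<Longrightarrow> A \<inter> B = {}
      \<Longrightarrow> e \<le> norm (mean A - mean B)"
    and I: "finite I" "A \<subseteq> I"
  shows "norm (\<Sum>i\<in>A. a i) \<le> (inverse d + inverse e) * norm (comb a I)"
proof -
  define s where "s = (\<Sum>i\<in>A. a i)"
  define t where "t = (\<Sum>i\<in>I - A. a i)"
  \<comment> \<open>The successor makes the targets nonempty even if \<open>I\<close> is empty.\<close>
  define N where "N = Suc (card I)"
  have A: "finite A" "card A \<le> N" "card (I - A) \<le> N"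
    using I by (auto simp: N_def card_mono finite_subset le_Suc_eq)
  obtain D :: "nat set" where D: "finite D" "card D = N" "D \<inter> {} = {}"
    using obtain_disjoint_set_of_card[of "{}" N] by auto
  obtain E where E: "finite E" "card E = N" "E \<inter> D = {}"
    using obtain_disjoint_set_of_card[OF D(1)] .
  have ne: "D \<noteq> {}" "E \<noteq> {}" using D E by (auto simp: N_def)
  have un: "A \<union> (I - A) = I" using I by auto
  have 1: "norm (sm s (mean D) + sm t (mean E)) \<le> norm (comb a I)"
    using norm_average_two_blocks_le[of "{}" A "I - A" D E a] A D E I ne un
    by (auto simp: s_def t_def)
  have 2: "norm (sm s (mean E) + sm t (mean D)) \<le> norm (comb a I)"
    using norm_average_two_blocks_le[of "{}" A "I - A" E D a] A D E I ne un
    by (auto simp: s_def t_def)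
  have "norm (s - t) * e \<le> norm (s - t) * norm (mean D - mean E)"
    using D E ne by (intro mult_left_mono e(2)) auto
  also have "\<dots> = norm ((sm s (mean D) + sm t (mean E)) - (sm s (mean E) + sm t (mean D)))"
    by (simp add: norm_scale[symmetric] scale_left_diff_distrib scale_right_diff_distrib algebra_simps)
  also have "\<dots> \<le> 2 * norm (comb a I)"
    using norm_triangle_ineq4[of "sm s (mean D) + sm t (mean E)" "sm s (mean E) + sm t (mean D)"] 1 2
    by simp
  finally have "norm (s - t) \<le> 2 * (inverse e * norm (comb a I))"
    using e(1) by (simp add: field_simps)
  moreover have "norm (s + t) \<le> inverse d * norm (comb a I)"
    using norm_sum_coeffs_le[OF d I(1), of a] sum.subset_diff[OF I(2,1), of a]
    by (simp add: s_def t_def add.commute)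
  moreover have "2 * norm s \<le> norm (s + t) + norm (s - t)"
    using norm_triangle_ineq[of "s + t" "s - t"] by (simp flip: mult_2 add: norm_mult)
  moreover have "0 \<le> inverse d * norm (comb a I)" using d(1) by simp
  ultimately show ?thesis
    by (simp add: s_def distrib_right)
qed

lemma norm_comb_le:
  obtains K where "0 \<le> K" "\<forall>a I. finite I \<longrightarrow> norm (comb a I) \<le> K * (\<Sum>i\<in>I. norm (a i))"
proof -
  obtain K where K: "max (norm (x n)) (onorm (x' n)) \<le> K" for n
    using basis by (auto simp: is_basis_def bdd_above_def)
  have xK: "norm (x n) \<le> K" for n using K[of n] by simp
  have "norm (comb a I) \<le> K * (\<Sum>i\<in>I. norm (a i))" for a I
  proof -
    have "norm (comb a I) \<le> (\<Sum>i\<in>I. norm (sm (a i) (x i)))" by (rule norm_sum)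
    also have "\<dots> \<le> (\<Sum>i\<in>I. norm (a i) * K)"
      by (intro sum_mono) (simp add: norm_scale mult_left_mono xK)
    finally show ?thesis by (simp add: sum_distrib_left mult.commute)
  qed
  moreover have "0 \<le> K" using xK[of 0] norm_ge_zero order_trans by blast
  ultimately show ?thesis using that by blast
qed

end

text \<open>
  The real and the complex case differ only in the constant \<open>c\<close> by which the largest partial sum of
  scalars dominates the sum of their absolute values.
\<close>

theorem symmetric_total_basis_equivalent_l1:
  fixes sm :: "'f::{real_normed_field, banach} \<Rightarrow> 'a::banach \<Rightarrow> 'a"
  assumes "normed_space_over sm"
    and total: "total_basis sm x x'" and sym: "one_symmetric sm x"
    and cond: "\<not> one_suppression_unconditional sm x x'"
    and subset_sum: "\<And>(a :: nat \<Rightarrow> 'f) I. finite I \<Longrightarrow>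
      \<exists>A\<subseteq>I. (\<Sum>i\<in>I. norm (a i)) \<le> c * norm (\<Sum>i\<in>A. a i)" and c: "0 \<le> c"
  shows "equivalent_l1 sm x"
proof -
  interpret normed_space_over sm by fact
  interpret symmetric_basis sm x x'
    using total sym by unfold_locales (simp_all add: total_basis_def)
  obtain d where d: "0 < d" "\<And>D. finite D \<Longrightarrow> D \<noteq> {} \<Longrightarrow> d \<le> norm (mean D)"
  proof -
    have "\<not> (\<forall>e>0. \<exists>D. finite D \<and> D \<noteq> {} \<and> norm (mean D) < e)"
      using small_means_imp_suppression cond by blast
    then show ?thesis using that by (auto simp: not_less)
  qed
  obtain e where e: "0 < e" "\<And>A B. finite A \<Longrightarrow> A \<noteq> {} \<Longrightarrow> finite B \<Longrightarrow> B \<noteq> {} \<Longrightarrow> A \<inter> B = {}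
      \<Longrightarrow> e \<le> norm (mean A - mean B)"
    using means_separated[OF total d] by blast
  obtain K where K: "0 \<le> K" "\<forall>a I. finite I \<longrightarrow> norm (comb a I) \<le> K * (\<Sum>i\<in>I. norm (a i))"
    using norm_comb_le .
  define L where "L = c * (inverse d + inverse e)"
  have L: "(\<Sum>i\<in>I. norm (a i)) \<le> L * norm (comb a I)" if I: "finite I" for a I
  proof -
    obtain A where A: "A \<subseteq> I" "(\<Sum>i\<in>I. norm (a i)) \<le> c * norm (\<Sum>i\<in>A. a i)"
      using subset_sum[OF I, of a] by auto
    have "norm (\<Sum>i\<in>A. a i) \<le> (inverse d + inverse e) * norm (comb a I)"
      by (rule norm_partial_sum_coeffs_le) (fact d e I A(1))+
    then have "c * norm (\<Sum>i\<in>A. a i) \<le> L * norm (comb a I)"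
      unfolding L_def mult.assoc by (rule mult_left_mono) (fact c)
    with A(2) show ?thesis by (rule order_trans)
  qed
  define C where "C = 1 + K + L"
  have "0 \<le> L" using c d(1) e(1) by (simp add: L_def)
  then have C: "1 \<le> C" "K \<le> C" "L \<le> C" using K(1) by (auto simp: C_def)
  have "inverse C * (\<Sum>i\<in>I. norm (a i)) \<le> norm (comb a I)"
    and "norm (comb a I) \<le> C * (\<Sum>i\<in>I. norm (a i))" if I: "finite I" for a I
  proof -
    have "(\<Sum>i\<in>I. norm (a i)) \<le> C * norm (comb a I)"
      using L[OF I, of a] mult_right_mono[OF C(3), of "norm (comb a I)"] by simp
    then show "inverse C * (\<Sum>i\<in>I. norm (a i)) \<le> norm (comb a I)"
      using C(1) by (simp add: field_simps)
    show "norm (comb a I) \<le> C * (\<Sum>i\<in>I. norm (a i))"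
      using K(2)[rule_format, OF I, of a] mult_right_mono[OF C(2), of "\<Sum>i\<in>I. norm (a i)"]
      by (simp add: sum_nonneg)
  qed
  then show ?thesis using C(1) unfolding equivalent_l1_def by blast
qed

theorem proposition3p7:
  fixes x :: "nat \<Rightarrow> 'a::banach" and x' :: "nat \<Rightarrow> 'a \<Rightarrow> real"
    and scaleC :: "complex \<Rightarrow> 'b::banach \<Rightarrow> 'b"
    and z :: "nat \<Rightarrow> 'b" and z' :: "nat \<Rightarrow> 'b \<Rightarrow> complex"
  shows "(total_basis scaleR x x' \<and> one_symmetric scaleR x \<and>
            \<not> one_suppression_unconditional scaleR x x'
          \<longrightarrow> equivalent_l1 scaleR x) \<and>
         (normed_space_over scaleC \<and> total_basis scaleC z z' \<and> one_symmetric scaleC z \<and>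
            \<not> one_suppression_unconditional scaleC z z'
          \<longrightarrow> equivalent_l1 scaleC z)"
proof (intro conjI impI; elim conjE)
  assume "total_basis scaleR x x'" "one_symmetric scaleR x"
    "\<not> one_suppression_unconditional scaleR x x'"
  with normed_space_over_scaleR show "equivalent_l1 scaleR x"
    by (rule symmetric_total_basis_equivalent_l1[where c = 2])
      (use real_subset_sum_ge_half in \<open>simp_all\<close>)
next
  assume "normed_space_over scaleC" "total_basis scaleC z z'" "one_symmetric scaleC z"
    "\<not> one_suppression_unconditional scaleC z z'"
  then show "equivalent_l1 scaleC z"
    by (rule symmetric_total_basis_equivalent_l1[where c = 4])
      (use complex_subset_sum_ge_quarter in \<open>simp_all\<close>)
qed

end
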